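(* For every $g\in\Lambda_{2n}$ the following relations hold: $$\mathcal F^{\pm}_{0|2n}(\partial_{\underline{\grave x}}\,g)=\pm i\,\underline{\grave y}\,\mathcal F^{\pm}_{0|2n}(g),\qquad \mathcal F^{\pm}_{0|2n}(\Delta_f\,g)=-\underline{\grave y}^2\,\mathcal F^{\pm}_{0|2n}(g),$$ $$\mathcal F^{\pm}_{0|2n}(\underline{\grave x}\,g)=\pm i\,\partial_{\underline{\grave y}}\,\mathcal F^{\pm}_{0|2n}(g),\qquad \mathcal F^{\pm}_{0|2n}(\underline{\grave x}^2g)=-\Delta_f\,\mathcal F^{\pm}_{0|2n}(g),$$ where on the right-hand side of the last relation $\Delta_f$ acts in the variables $\grave y_j$.
   Context: Let $n\ge 0$ be an integer. $\Lambda_{2n}$ is the Grassmann algebra (complex coefficients) generated by anti-commuting variables $\grave x_1,\dots,\grave x_{2n}$; $\grave y_1,\dots,\grave y_{2n}$ is a second such set, and all $\grave x_i,\grave y_j$ anti-commute with each other. $\grave e_1,\dots,\grave e_{2n}$ generate a unital associative (Weyl) algebra with relations $\grave e_{2j}\grave e_{2k}-\grave e_{2k}\grave e_{2j}=0$, $\grave e_{2j-1}\grave e_{2k-1}-\grave e_{2k-1}\grave e_{2j-1}=0$, $\grave e_{2j-1}\grave e_{2k}-\grave e_{2k}\grave e_{2j-1}=\delta_{jk}$, and commute with all variables. $\partial_{\grave x_j}$ is the left derivative. $\underline{\grave x}=\sum_{j=1}^{2n}\grave x_j\grave e_j$, so $\underline{\grave x}^2=\sum_{j=1}^n\grave x_{2j-1}\grave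 x_{2j}$; $\partial_{\underline{\grave x}}=2\sum_{j=1}^n(\grave e_{2j}\partial_{\grave x_{2j-1}}-\grave e_{2j-1}\partial_{\grave x_{2j}})$; $\Delta_f=\partial_{\underline{\grave x}}^2=4\sum_{j=1}^n\partial_{\grave x_{2j-1}}\partial_{\grave x_{2j}}$; analogously for $y$. Berezin integral: $\int_{B,x}=\pi^{-n}\partial_{\grave x_{2n}}\cdots\partial_{\grave x_1}$. Fermionic Fourier transform (extended linearly to coefficients in the algebra generated by the $\grave e_j$): $$\mathcal F^{\pm}_{0|2n}(g)(y)=(2\pi)^n\int_{B,x}K^{\pm}(x,y)\,g(x),\qquad K^{\pm}(x,y)=\exp\left(\mp\frac i2\sum_{j=1}^n(\grave x_{2j-1}\grave y_{2j}-\grave x_{2j}\grave y_{2j-1})\right).$$ *)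

theory Defs
  imports Complex_Main "HOL-Library.Poly_Mapping"
begin

text \<open>
  The Grassmann algebra in the variables \<open>x\<^sub>i\<close>, \<open>y\<^sub>i\<close>, with coefficients extended by the Weyl
  algebra of the \<open>e\<^sub>i\<close>, is built from its presentation: the free unital complex algebra on all
  these letters modulo the two-sided ideal generated by the relations. All indices \<open>i :: nat\<close> are
  provided at once, so that \<open>n\<close> can be an ordinary variable; the algebra belonging to a given \<open>n\<close>
  is the subalgebra generated by the letters with indices \<open>1, \<dots>, 2n\<close>. Indices start at \<open>1\<close>,
  and letters with index \<open>0\<close> are never used.
\<close>

datatype var = X nat | Y nat
datatype letter = V var | E nat

text \<open>Words form the free monoid; polynomial mappings over it form the free algebra.\<close>

instantiation list :: (type) monoid_add
begin
definition zero_list :: "'a list" where "zero_list = []"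
definition plus_list :: "'a list \<Rightarrow> 'a list \<Rightarrow> 'a list" where "plus_list = (@)"
instance by standard (simp_all add: zero_list_def plus_list_def)
end

type_synonym free_algebra = "letter list \<Rightarrow>\<^sub>0 complex"

definition mon :: "letter list \<Rightarrow> free_algebra" where
  "mon w = Poly_Mapping.single w 1"

definition const :: "complex \<Rightarrow> free_algebra" where
  "const c = Poly_Mapping.single [] c"

definition relators :: "free_algebra set" where
  "relators =
     {mon [V u, V v] + mon [V v, V u] | u v. True}
   \<union> {mon [E i, V v] - mon [V v, E i] | i v. True}
   \<union> {mon [E (2*j), E (2*k)] - mon [E (2*k), E (2*j)] | j k. j \<ge> 1 \<and> k \<ge> 1}
   \<union> {mon [E (2*j-1), E (2*k-1)] - mon [E (2*k-1), E (2*j-1)] | j k. j \<ge> 1 \<and> k \<ge> 1}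
   \<union> {mon [E (2*j-1), E (2*k)] - mon [E (2*k), E (2*j-1)] - const (if j = k then 1 else 0)
        | j k. j \<ge> 1 \<and> k \<ge> 1}"

inductive_set rel_ideal :: "free_algebra set" where
  relator: "r \<in> relators \<Longrightarrow> r \<in> rel_ideal"
| add: "p \<in> rel_ideal \<Longrightarrow> q \<in> rel_ideal \<Longrightarrow> p + q \<in> rel_ideal"
| mult: "p \<in> rel_ideal \<Longrightarrow> a * p * b \<in> rel_ideal"

lemma mon_Nil: "mon [] = 1"
  by (metis mon_def single_one zero_list_def)

lemma const_1: "const 1 = 1"
  by (metis const_def single_one zero_list_def)

lemma mon_append: "mon (v @ w) = mon v * mon w"
  by (simp add: mon_def mult_single plus_list_def)

lemma const_mult_single: "const c * Poly_Mapping.single w d = Poly_Mapping.single w (c * d)"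
  by (simp add: const_def mult_single plus_list_def)

lemma single_eq: "Poly_Mapping.single w c = const c * mon w"
  by (simp add: const_mult_single mon_def)

lemma const_add: "const (c + d) = const c + const d"
  by (simp add: const_def single_add)

lemma const_0: "const 0 = 0"
  by (simp add: const_def)

lemma const_mult: "const (c * d) = const c * const d"
  by (simp add: const_def mult_single plus_list_def)

lemma const_uminus: "const (- c) = - const c"
  using const_add[of c "- c"] by (simp add: const_0 eq_neg_iff_add_eq_0 add.commute)

lemma free_algebra_induct [case_names zero single add]:
  fixes p :: free_algebra
  assumes "P 0" "\<And>w c. P (Poly_Mapping.single w c)" "\<And>p q. P p \<Longrightarrow> P q \<Longrightarrow> P (p + q)"
  shows "P p"
proof (induction p rule: update_induct)
  case const
  show ?case by (rule assms)
next
  case (update f a b)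
  have "Poly_Mapping.update a b f = f + Poly_Mapping.single a b"
    using update(1)
    by (intro poly_mapping_eqI) (auto simp: lookup_add lookup_single lookup_update in_keys_iff when_def)
  then show ?case using assms(2,3) update(3) by simp
qed

lemma const_commute: "const c * p = p * const c"
  by (induction p rule: free_algebra_induct)
     (simp_all add: const_def mult_single plus_list_def algebra_simps)

lemma const_left_commute: "p * (const c * q) = const c * (p * q)"
  by (simp add: const_commute[of c p] flip: mult.assoc)

lemma zero_in_rel_ideal: "0 \<in> rel_ideal"
proof -
  have "mon [V (X 0), V (X 0)] + mon [V (X 0), V (X 0)] \<in> relators"
    unfolding relators_def by blast
  from rel_ideal.mult[OF rel_ideal.relator[OF this], of 0 0] show ?thesis by simp
qed

lemma mult_left_rel_ideal: "p \<in> rel_ideal \<Longrightarrow> a * p \<in> rel_ideal"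
  using rel_ideal.mult[of p a 1] by simp

lemma mult_right_rel_ideal: "p \<in> rel_ideal \<Longrightarrow> p * b \<in> rel_ideal"
  using rel_ideal.mult[of p 1 b] by simp

lemma uminus_rel_ideal: "p \<in> rel_ideal \<Longrightarrow> - p \<in> rel_ideal"
  using mult_left_rel_ideal[of p "-1"] by simp

lemma diff_rel_ideal: "p \<in> rel_ideal \<Longrightarrow> q \<in> rel_ideal \<Longrightarrow> p - q \<in> rel_ideal"
  using rel_ideal.add[OF _ uminus_rel_ideal[of q], of p] by simp

text \<open>
  The relations do not collapse: the \<open>x\<^sub>i\<close>, \<open>y\<^sub>i\<close> act as creation operators and \<open>e\<^bsub>2j-1\<^esub>\<close>, \<open>e\<^bsub>2j\<^esub>\<close> as
  \<open>\<partial>/\<partial>t\<^sub>j\<close>, \<open>t\<^sub>j\<close> on families of coefficients indexed by sets of variables and exponents of \<open>t\<close>.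
\<close>

fun pos :: "var \<Rightarrow> nat" where
  "pos (X i) = 2 * i"
| "pos (Y i) = 2 * i + 1"

type_synonym coeffs = "var set \<Rightarrow> (nat \<Rightarrow> nat) \<Rightarrow> complex"

fun act_letter :: "letter \<Rightarrow> coeffs \<Rightarrow> coeffs" where
  "act_letter (V v) f = (\<lambda>S a. if v \<in> S then (-1) ^ card {u \<in> S. pos u < pos v} * f (S - {v}) a else 0)"
| "act_letter (E i) f = (\<lambda>S a. if even i
     then (if a (i div 2) = 0 then 0 else f S (a(i div 2 := a (i div 2) - 1)))
     else of_nat (a (Suc i div 2) + 1) * f S (a(Suc i div 2 := a (Suc i div 2) + 1)))"

definition act_word :: "letter list \<Rightarrow> coeffs \<Rightarrow> coeffs" where
  "act_word w = foldr act_letter w"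

definition act :: "free_algebra \<Rightarrow> coeffs \<Rightarrow> coeffs" where
  "act p f S a = (\<Sum>w\<in>Poly_Mapping.keys p. Poly_Mapping.lookup p w * act_word w f S a)"

lemma act_add: "act (p + q) f S a = act p f S a + act q f S a"
  unfolding act_def
  by (rule setsum_keys_plus_distrib[of "\<lambda>w c. c * act_word w f S a"]) (auto simp: algebra_simps)

lemma act_single: "act (Poly_Mapping.single w c) f S a = c * act_word w f S a"
  by (cases "c = 0") (simp_all add: act_def)

lemma act_0: "act 0 f S a = 0"
  by (simp add: act_def)

lemma act_letter_add:
  "act_letter l (\<lambda>S a. f S a + g S a) = (\<lambda>S a. act_letter l f S a + act_letter l g S a)"
  by (cases l) (auto simp: fun_eq_iff algebra_simps)

lemma act_letter_scale:
  "act_letter l (\<lambda>S a. c * f S a) = (\<lambda>S a. c * act_letter l f S a)"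
  by (cases l) (auto simp: fun_eq_iff algebra_simps)

lemma act_word_add:
  "act_word w (\<lambda>S a. f S a + g S a) = (\<lambda>S a. act_word w f S a + act_word w g S a)"
  by (induction w) (simp_all add: act_word_def act_letter_add)

lemma act_word_scale:
  "act_word w (\<lambda>S a. c * f S a) = (\<lambda>S a. c * act_word w f S a)"
  by (induction w) (simp_all add: act_word_def act_letter_scale)

lemma act_word_zero: "act_word w (\<lambda>S a. 0) = (\<lambda>S a. 0)"
  using act_word_scale[of w 0 "\<lambda>S a. 0"] by simp

lemma act_word_append: "act_word (v @ w) f = act_word v (act_word w f)"
  by (simp add: act_word_def)

lemma act_mult: "act (p * q) f S a = act p (act q f) S a"
proof (induction p arbitrary: S a rule: free_algebra_induct)
  case zero
  then show ?case by (simp add: act_0)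
next
  case (add p p')
  then show ?case by (simp add: act_add distrib_right)
next
  case (single v c)
  show ?case
  proof (induction q arbitrary: S a rule: free_algebra_induct)
    case zero
    have "act 0 f = (\<lambda>S a. 0)" by (simp add: fun_eq_iff act_0)
    then show ?case by (simp add: act_0 act_single act_word_zero)
  next
    case (add q q')
    have "act (q + q') f = (\<lambda>S a. act q f S a + act q' f S a)" by (simp add: fun_eq_iff act_add)
    then show ?case using add by (simp add: act_add act_single act_word_add distrib_left)
  next
    case (single w d)
    have "act (Poly_Mapping.single w d) f = (\<lambda>S a. d * act_word w f S a)"
      by (simp add: fun_eq_iff act_single)
    then show ?case
      by (simp add: mult_single act_single act_word_scale act_word_append plus_list_def)
  qed
qed

lemma act_zero: "act p (\<lambda>S a. 0) S a = 0"
  by (simp add: act_def act_word_zero)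

lemma act_uminus: "act (- p) f S a = - act p f S a"
  using act_add[of p "- p" f S a] by (simp add: act_0 eq_neg_iff_add_eq_0 add.commute)

lemma act_diff: "act (p - q) f S a = act p f S a - act q f S a"
  using act_add[of p "- q"] by (simp add: act_uminus)

lemma act_mon2: "act (mon [k, l]) f S a = act_letter k (act_letter l f) S a"
  by (simp add: mon_def act_single act_word_def)

lemma act_const: "act (const c) f S a = c * f S a"
  by (simp add: const_def act_single act_word_def)

lemma pos_inject: "pos u = pos v \<longleftrightarrow> u = v"
  by (cases u; cases v) (auto; presburger)+

lemma finite_pos_less: "finite {u \<in> S. pos u < m}"
proof (rule finite_subset)
  show "{u \<in> S. pos u < m} \<subseteq> X ` {..m} \<union> Y ` {..m}"
  proof
    fix u assume "u \<in> {u \<in> S. pos u < m}"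
    then show "u \<in> X ` {..m} \<union> Y ` {..m}" by (cases u) auto
  qed
qed auto

lemma act_vars:
  assumes "pos u < pos v"
  shows "act_letter (V u) (act_letter (V v) f) S a + act_letter (V v) (act_letter (V u) f) S a = 0"
proof (cases "u \<in> S \<and> v \<in> S")
  case True
  let ?A = "{w \<in> S. pos w < pos v}"
  have "{w \<in> S - {u}. pos w < pos v} = ?A - {u}" by auto
  moreover have "Suc (card (?A - {u})) = card ?A"
    by (rule card_Suc_Diff1) (use True assms finite_pos_less in auto)
  ultimately have 1: "card ?A = Suc (card {w \<in> S - {u}. pos w < pos v})" by simp
  have 2: "{w \<in> S - {v}. pos w < pos u} = {w \<in> S. pos w < pos u}" using assms by auto
  have 3: "S - {u} - {v} = S - {u, v}" "S - {v} - {u} = S - {u, v}" by auto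
  have "u \<noteq> v" using assms by auto
  then have "u \<in> S - {v}" "v \<in> S - {u}" using True by auto
  then show ?thesis using True by (simp only: act_letter.simps if_True 1 2 3) simp
next
  case False
  then show ?thesis by auto
qed

lemma act_relators:
  assumes "r \<in> relators"
  shows "act r f S a = 0"
proof -
  consider
      (vv) u v where "r = mon [V u, V v] + mon [V v, V u]"
    | (ev) i v where "r = mon [E i, V v] - mon [V v, E i]"
    | (ee) j k where "r = mon [E (2*j), E (2*k)] - mon [E (2*k), E (2*j)]"
    | (oo) j k where "j \<ge> 1" "k \<ge> 1" "r = mon [E (2*j-1), E (2*k-1)] - mon [E (2*k-1), E (2*j-1)]"
    | (oe) j k where "j \<ge> 1" "k \<ge> 1"
        "r = mon [E (2*j-1), E (2*k)] - mon [E (2*k), E (2*j-1)] - const (if j = k then 1 else 0)"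
    using assms unfolding relators_def by auto
  then show ?thesis
  proof cases
    case vv
    consider "u = v" | "pos u < pos v" | "pos v < pos u"
      using pos_inject[of u v] by linarith
    then have "act_letter (V u) (act_letter (V v) f) S a + act_letter (V v) (act_letter (V u) f) S a = 0"
    proof cases
      case 1
      then show ?thesis by simp
    next
      case 2
      then show ?thesis by (rule act_vars)
    next
      case 3
      then show ?thesis using act_vars[of v u f S a] by (simp only: add.commute)
    qed
    then show ?thesis by (simp only: vv act_add act_mon2)
  next
    case ev
    then show ?thesis by (auto simp add: act_0 act_diff act_mon2)
  next
    case ee
    then show ?thesis by (cases "j = k") (auto simp add: act_0 act_diff act_mon2 fun_upd_twist)
  next
    case oo
    then obtain j' k' where "j = Suc j'" "k = Suc k'" by (metis Suc_le_D One_nat_def)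
    then show ?thesis using oo by (cases "j = k") (auto simp add: act_0 act_diff act_mon2 fun_upd_twist)
  next
    case oe
    then obtain j' k' where jk: "j = Suc j'" "k = Suc k'" by (metis Suc_le_D One_nat_def)
    show ?thesis
      unfolding oe(3) act_diff act_mon2 act_const jk
      by (cases "j' = k'") (auto simp add: fun_upd_twist of_nat_diff algebra_simps)
  qed
qed

lemma act_rel_ideal: "p \<in> rel_ideal \<Longrightarrow> act p f S a = 0"
proof (induction arbitrary: f S a rule: rel_ideal.induct)
  case (mult p a' b)
  have "act p (act b f) = (\<lambda>S a. 0)" using mult.IH by (simp add: fun_eq_iff)
  then show ?case by (simp add: act_mult act_zero)
qed (simp_all add: act_relators act_add)

lemma one_notin_rel_ideal: "1 \<notin> rel_ideal"
  using act_rel_ideal[of 1 "\<lambda>S a. 1" "{}" "\<lambda>_. 0"] act_const[of 1 "\<lambda>S a. 1" "{}" "\<lambda>_. 0"]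
  by (auto simp: const_1)

subsection \<open>Left derivatives on the free algebra\<close>

definition lin :: "(letter list \<Rightarrow> free_algebra) \<Rightarrow> free_algebra \<Rightarrow> free_algebra" where
  "lin f p = (\<Sum>w\<in>Poly_Mapping.keys p. const (Poly_Mapping.lookup p w) * f w)"

fun deriv_word :: "var \<Rightarrow> letter list \<Rightarrow> free_algebra" where
  "deriv_word v [] = 0"
| "deriv_word v (V u # w) = (if u = v then mon w else 0) - mon [V u] * deriv_word v w"
| "deriv_word v (E i # w) = mon [E i] * deriv_word v w"

fun sign_word :: "letter list \<Rightarrow> complex" where
  "sign_word [] = 1"
| "sign_word (V u # w) = - sign_word w"
| "sign_word (E i # w) = sign_word w"

abbreviation "free_deriv v \<equiv> lin (deriv_word v)"
abbreviation "parity \<equiv> lin (\<lambda>w. const (sign_word w) * mon w)"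

lemma lin_add: "lin f (p + q) = lin f p + lin f q"
  unfolding lin_def
  by (rule setsum_keys_plus_distrib[of "\<lambda>w c. const c * f w"])
     (auto simp: const_add const_0 distrib_right)

lemma lin_single: "lin f (Poly_Mapping.single w c) = const c * f w"
  by (cases "c = 0") (simp_all add: lin_def const_0)

lemma lin_mon: "lin f (mon w) = f w"
  by (simp add: mon_def lin_single const_1)

lemma lin_const: "lin f (const c) = const c * f []"
  by (simp add: const_def[of c] lin_single)

lemma lin_0: "lin f 0 = 0"
  by (simp add: lin_def)

lemma lin_uminus: "lin f (- p) = - lin f p"
  using lin_add[of f p "- p"] by (simp add: lin_0 eq_neg_iff_add_eq_0 add.commute)

lemma lin_diff: "lin f (p - q) = lin f p - lin f q"
  using lin_add[of f p "- q"] by (simp add: lin_uminus)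

lemma sign_word_append: "sign_word (v @ w) = sign_word v * sign_word w"
  by (induction v rule: sign_word.induct) auto

lemma mon_Cons: "mon (l # w) = mon [l] * mon w"
  using mon_append[of "[l]" w] by simp

lemma deriv_word_append:
  "deriv_word x (v @ w) = deriv_word x v * mon w + const (sign_word v) * mon v * deriv_word x w"
proof (induction v rule: sign_word.induct)
  case 1
  then show ?case by (simp add: const_1 mon_Nil)
next
  case (2 u v)
  have "mon [V u] * (const (sign_word v) * mon v) = const (sign_word v) * mon (V u # v)"
    by (metis const_commute mon_Cons mult.assoc)
  with 2 show ?case
    by (simp add: algebra_simps mon_append const_uminus flip: mult.assoc)
next
  case (3 i v)
  have "mon [E i] * (const (sign_word v) * mon v) = const (sign_word v) * mon (E i # v)"
    by (metis const_commute mon_Cons mult.assoc)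
  with 3 show ?case
    by (simp add: algebra_simps flip: mult.assoc)
qed

lemma parity_mult: "parity (p * q) = parity p * parity q"
proof (induction p rule: free_algebra_induct)
  case (single v c)
  show ?case
  proof (induction q rule: free_algebra_induct)
    case (single w d)
    have "parity (Poly_Mapping.single v c * Poly_Mapping.single w d)
      = Poly_Mapping.single (v @ w) (c * d * (sign_word v * sign_word w))"
      by (simp add: mult_single plus_list_def lin_single sign_word_append mon_def const_mult_single)
    then show ?case
      by (simp add: lin_single mon_def const_mult_single mult_single plus_list_def ac_simps)
  qed (simp_all add: lin_0 lin_add distrib_left)
qed (simp_all add: lin_0 lin_add distrib_right)

lemma free_deriv_mult: "free_deriv x (p * q) = free_deriv x p * q + parity p * free_deriv x q"
proof (induction p rule: free_algebra_induct)
  case (single v c)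
  show ?case
  proof (induction q rule: free_algebra_induct)
    case (single w d)
    let ?A = "deriv_word x v" and ?B = "deriv_word x w" and ?s = "sign_word v"
    have "free_deriv x (Poly_Mapping.single v c * Poly_Mapping.single w d)
      = const (c * d) * (?A * mon w) + const (c * d) * (const ?s * mon v * ?B)"
      by (simp add: mult_single plus_list_def lin_single deriv_word_append distrib_left)
    also have "const (c * d) * (?A * mon w) = const c * ?A * (const d * mon w)"
      by (simp only: const_mult mult.assoc const_left_commute[of ?A])
    also have "const (c * d) * (const ?s * mon v * ?B) = const c * (const ?s * mon v) * (const d * ?B)"
      by (simp only: const_mult mult.assoc const_left_commute[of "mon v"] const_left_commute[of "const ?s"])
    finally show ?case
      by (simp add: lin_single) (simp add: single_eq mult.assoc)
  qed (simp_all add: lin_0 lin_add algebra_simps)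
qed (simp_all add: lin_0 lin_add algebra_simps)

lemma parity_relators: "r \<in> relators \<Longrightarrow> parity r \<in> rel_ideal"
proof -
  assume r: "r \<in> relators"
  have "parity r = r \<or> parity r = - r"
    using r unfolding relators_def
    by (auto simp: lin_add lin_diff lin_mon lin_const const_1 const_uminus mon_Nil)
  then show ?thesis
    using r rel_ideal.relator uminus_rel_ideal by metis
qed

lemma free_deriv_relators: "r \<in> relators \<Longrightarrow> free_deriv x r = 0"
  unfolding relators_def
  by (auto simp: lin_add lin_diff lin_mon lin_const mon_Nil)

lemma parity_rel_ideal: "p \<in> rel_ideal \<Longrightarrow> parity p \<in> rel_ideal"
proof (induction rule: rel_ideal.induct)
  case (mult p a b)
  then show ?case by (simp add: parity_mult rel_ideal.mult)
qed (simp_all add: parity_relators lin_add rel_ideal.add)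

lemma free_deriv_rel_ideal: "p \<in> rel_ideal \<Longrightarrow> free_deriv x p \<in> rel_ideal"
proof (induction rule: rel_ideal.induct)
  case (mult p a b)
  have "free_deriv x (a * p * b) =
      (free_deriv x a * p * b + parity a * free_deriv x p * b) + parity a * parity p * free_deriv x b"
    by (simp add: free_deriv_mult parity_mult algebra_simps)
  moreover have "free_deriv x a * p * b \<in> rel_ideal" "parity a * free_deriv x p * b \<in> rel_ideal"
      "parity a * parity p * free_deriv x b \<in> rel_ideal"
    using mult parity_rel_ideal by (auto intro: rel_ideal.mult)
  ultimately show ?case by (simp add: rel_ideal.add)
qed (simp_all add: free_deriv_relators zero_in_rel_ideal lin_add rel_ideal.add)

subsection \<open>The algebra\<close>

quotient_type superalgebra = free_algebra / "\<lambda>p q. p - q \<in> rel_ideal"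
proof (rule equivpI)
  show "reflp (\<lambda>p q. p - q \<in> rel_ideal)"
    by (simp add: reflp_def zero_in_rel_ideal)
  show "symp (\<lambda>p q. p - q \<in> rel_ideal)"
    using uminus_rel_ideal by (fastforce simp: symp_def)
  show "transp (\<lambda>p q. p - q \<in> rel_ideal)"
    using rel_ideal.add by (fastforce simp: transp_def)
qed

instantiation superalgebra :: ring_1
begin

lift_definition zero_superalgebra :: superalgebra is 0 .

lift_definition one_superalgebra :: superalgebra is 1 .

lift_definition plus_superalgebra :: "superalgebra \<Rightarrow> superalgebra \<Rightarrow> superalgebra" is "(+)"
proof -
  fix p p' q q' :: free_algebra
  assume "p - p' \<in> rel_ideal" "q - q' \<in> rel_ideal"
  then have "(p - p') + (q - q') \<in> rel_ideal" by (rule rel_ideal.add)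
  then show "(p + q) - (p' + q') \<in> rel_ideal" by (simp add: algebra_simps)
qed

lift_definition uminus_superalgebra :: "superalgebra \<Rightarrow> superalgebra" is uminus
proof -
  fix p p' :: free_algebra
  assume "p - p' \<in> rel_ideal"
  then show "- p - - p' \<in> rel_ideal" using uminus_rel_ideal by fastforce
qed

lift_definition minus_superalgebra :: "superalgebra \<Rightarrow> superalgebra \<Rightarrow> superalgebra" is "(-)"
proof -
  fix p p' q q' :: free_algebra
  assume "p - p' \<in> rel_ideal" "q - q' \<in> rel_ideal"
  then have "(p - p') - (q - q') \<in> rel_ideal" by (rule diff_rel_ideal)
  then show "(p - q) - (p' - q') \<in> rel_ideal" by (simp add: algebra_simps)
qed

lift_definition times_superalgebra :: "superalgebra \<Rightarrow> superalgebra \<Rightarrow> superalgebra" is "(*)"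
proof -
  fix p p' q q' :: free_algebra
  assume "p - p' \<in> rel_ideal" "q - q' \<in> rel_ideal"
  then have "(p - p') * q + p' * (q - q') \<in> rel_ideal"
    by (intro rel_ideal.add mult_left_rel_ideal mult_right_rel_ideal)
  then show "p * q - p' * q' \<in> rel_ideal" by (simp add: algebra_simps)
qed

instance
proof
  fix a b c :: superalgebra
  show "a * b * c = a * (b * c)" by transfer (simp add: mult.assoc zero_in_rel_ideal)
  show "1 * a = a" by transfer (simp add: zero_in_rel_ideal)
  show "a * 1 = a" by transfer (simp add: zero_in_rel_ideal)
  show "a + b + c = a + (b + c)" by transfer (simp add: add.assoc zero_in_rel_ideal)
  show "a + b = b + a" by transfer (simp add: add.commute zero_in_rel_ideal)
  show "0 + a = a" by transfer (simp add: zero_in_rel_ideal)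
  show "- a + a = 0" by transfer (simp add: zero_in_rel_ideal)
  show "a - b = a + - b" by transfer (simp add: zero_in_rel_ideal)
  show "(a + b) * c = a * c + b * c" by transfer (simp add: algebra_simps zero_in_rel_ideal)
  show "a * (b + c) = a * b + a * c" by transfer (simp add: algebra_simps zero_in_rel_ideal)
  show "(0::superalgebra) \<noteq> 1"
    by transfer (use one_notin_rel_ideal uminus_rel_ideal[of "- 1"] in auto)
qed

end

lift_definition scalar :: "complex \<Rightarrow> superalgebra" is const .

abbreviation scale :: "complex \<Rightarrow> superalgebra \<Rightarrow> superalgebra" (infixr "\<cdot>" 75) where
  "c \<cdot> a \<equiv> scalar c * a"

lift_definition var :: "var \<Rightarrow> superalgebra" is "\<lambda>v. mon [V v]" .

lift_definition ge :: "nat \<Rightarrow> superalgebra" is "\<lambda>i. mon [E i]" .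

lift_definition left_deriv :: "var \<Rightarrow> superalgebra \<Rightarrow> superalgebra" ("\<partial>") is free_deriv
  by (metis free_deriv_rel_ideal lin_diff)

lemma var_anticommute: "var u * var v = - (var v * var u)"
proof transfer
  fix u v
  have "mon [V u, V v] + mon [V v, V u] \<in> relators"
    unfolding relators_def by blast
  from rel_ideal.relator[OF this] show "mon [V u] * mon [V v] - - (mon [V v] * mon [V u]) \<in> rel_ideal"
    by (simp flip: mon_append)
qed

lemma e_var_commute: "ge i * var v = var v * ge i"
proof transfer
  fix i v
  have "mon [E i, V v] - mon [V v, E i] \<in> relators"
    unfolding relators_def by blast
  from rel_ideal.relator[OF this] show "mon [E i] * mon [V v] - mon [V v] * mon [E i] \<in> rel_ideal"
    by (simp flip: mon_append)
qed

lemma e_even_commute: "j \<ge> 1 \<Longrightarrow> k \<ge> 1 \<Longrightarrow> ge (2*j) * ge (2*k) - ge (2*k) * ge (2*j) = 0"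
proof transfer
  fix j k :: nat
  assume "j \<ge> 1" "k \<ge> 1"
  then have "mon [E (2*j), E (2*k)] - mon [E (2*k), E (2*j)] \<in> relators"
    unfolding relators_def by blast
  from rel_ideal.relator[OF this] show "mon [E (2*j)] * mon [E (2*k)] - mon [E (2*k)] * mon [E (2*j)] - 0 \<in> rel_ideal"
    by (simp flip: mon_append)
qed

lemma e_odd_commute:
  "j \<ge> 1 \<Longrightarrow> k \<ge> 1 \<Longrightarrow> ge (2*j-1) * ge (2*k-1) - ge (2*k-1) * ge (2*j-1) = 0"
proof transfer
  fix j k :: nat
  assume "j \<ge> 1" "k \<ge> 1"
  then have "mon [E (2*j-1), E (2*k-1)] - mon [E (2*k-1), E (2*j-1)] \<in> relators"
    unfolding relators_def by blast
  from rel_ideal.relator[OF this] show "mon [E (2*j-1)] * mon [E (2*k-1)] - mon [E (2*k-1)] * mon [E (2*j-1)] - 0 \<in> rel_ideal"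
    by (simp flip: mon_append)
qed

lemma e_odd_even:
  "j \<ge> 1 \<Longrightarrow> k \<ge> 1 \<Longrightarrow> ge (2*j-1) * ge (2*k) - ge (2*k) * ge (2*j-1) = scalar (if j = k then 1 else 0)"
proof transfer
  fix j k :: nat
  assume "j \<ge> 1" "k \<ge> 1"
  then have "mon [E (2*j-1), E (2*k)] - mon [E (2*k), E (2*j-1)]
      - const (if j = k then 1 else 0) \<in> relators"
    unfolding relators_def by (intro UnI2) blast
  from rel_ideal.relator[OF this] show "mon [E (2*j-1)] * mon [E (2*k)] - mon [E (2*k)] * mon [E (2*j-1)]
      - const (if j = k then 1 else 0) \<in> rel_ideal"
    by (simp only: mon_append[symmetric] append_Cons append_Nil)
qed

lemma deriv_scalar: "\<partial> v (scalar c) = 0"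
  by transfer (simp add: lin_const zero_in_rel_ideal)

lemma deriv_add: "\<partial> v (f + g) = \<partial> v f + \<partial> v g"
  by transfer (simp add: lin_add zero_in_rel_ideal)

lemma deriv_var_mult: "\<partial> v (var u * f) = (if u = v then f else 0) - var u * \<partial> v f"
  by transfer (auto simp: free_deriv_mult lin_mon mon_Nil const_uminus const_1 zero_in_rel_ideal)

lemma deriv_e_mult: "\<partial> v (ge i * f) = ge i * \<partial> v f"
  by transfer (auto simp: free_deriv_mult lin_mon mon_Nil const_1 zero_in_rel_ideal)

subsection \<open>The Fourier transform\<close>

abbreviation gx :: "nat \<Rightarrow> superalgebra" where "gx i \<equiv> var (X i)"
abbreviation gy :: "nat \<Rightarrow> superalgebra" where "gy i \<equiv> var (Y i)"

inductive_set Lambda :: "nat \<Rightarrow> superalgebra set" for m :: nat where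
  scalar: "scalar c \<in> Lambda m"
| gen: "1 \<le> i \<Longrightarrow> i \<le> m \<Longrightarrow> gx i \<in> Lambda m"
| add: "f \<in> Lambda m \<Longrightarrow> g \<in> Lambda m \<Longrightarrow> f + g \<in> Lambda m"
| mult: "f \<in> Lambda m \<Longrightarrow> g \<in> Lambda m \<Longrightarrow> f * g \<in> Lambda m"

text \<open>The argument \<open>Z\<close> is \<^const>\<open>X\<close> or \<^const>\<open>Y\<close>, according to the set of variables in use.\<close>

definition vector_variable :: "nat \<Rightarrow> (nat \<Rightarrow> var) \<Rightarrow> superalgebra" where
  "vector_variable n Z = (\<Sum>j=1..2*n. var (Z j) * ge j)"

definition dirac :: "nat \<Rightarrow> (nat \<Rightarrow> var) \<Rightarrow> superalgebra \<Rightarrow> superalgebra" where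
  "dirac n Z f = 2 \<cdot> (\<Sum>j=1..n. ge (2*j) * \<partial> (Z (2*j-1)) f - ge (2*j-1) * \<partial> (Z (2*j)) f)"

definition laplace :: "nat \<Rightarrow> (nat \<Rightarrow> var) \<Rightarrow> superalgebra \<Rightarrow> superalgebra" where
  "laplace n Z f = dirac n Z (dirac n Z f)"

text \<open>\<^const>\<open>fold\<close> applies \<open>\<partial> (X 1)\<close> first and \<open>\<partial> (X (2*n))\<close> last.\<close>

definition berezin :: "nat \<Rightarrow> superalgebra \<Rightarrow> superalgebra" where
  "berezin n f = complex_of_real (1 / pi ^ n) \<cdot> fold (\<lambda>i. \<partial> (X i)) [1..<2*n+1] f"

text \<open>Exponential of a nilpotent element; \<^const>\<open>Sum_any\<close> sums over the finitely many nonzero terms.\<close>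

definition nilpotent_exp :: "superalgebra \<Rightarrow> superalgebra" where
  "nilpotent_exp a = Sum_any (\<lambda>k. (1 / fact k) \<cdot> a ^ k)"

text \<open>The sign \<open>\<pm>\<close> is \<open>\<sigma> \<in> {1, -1}\<close>.\<close>

definition fourier_kernel :: "complex \<Rightarrow> nat \<Rightarrow> superalgebra" where
  "fourier_kernel \<sigma> n = nilpotent_exp
     ((- \<sigma> * \<i> / 2) \<cdot> (\<Sum>j=1..n. gx (2*j-1) * gy (2*j) - gx (2*j) * gy (2*j-1)))"

text \<open>
  As \<^const>\<open>left_deriv\<close> acts on the whole algebra and treats the \<open>e\<^sub>i\<close> as constants, this formula also gives
  the linear extension of the transform to coefficients in the Weyl algebra.
\<close>

definition fourier :: "complex \<Rightarrow> nat \<Rightarrow> superalgebra \<Rightarrow> superalgebra" where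
  "fourier \<sigma> n g = complex_of_real ((2 * pi) ^ n) \<cdot> berezin n (fourier_kernel \<sigma> n * g)"

end

theory Submission
  imports Defs
begin

text \<open>
  The kernel is an even central element with \<open>\<partial> v K = \<partial> v A * K\<close>, where \<open>A\<close> is its exponent, so it obeys
  an ungraded Leibniz rule. The Berezin integral annihilates derivatives in the \<open>x\<^sub>i\<close> and, consisting of
  an even number of derivatives, commutes with the \<open>y\<^sub>i\<close> and with derivatives in them. Integration by
  parts then turns \<open>\<partial> (X i)\<close> into multiplication by a multiple of some \<open>y\<^sub>k\<close>, and differentiation under
  the integral turns multiplication by \<open>x\<^sub>i\<close> into a multiple of some \<open>\<partial> (Y k)\<close>, as \<open>g\<close> does not depend
  on \<open>y\<close>.
\<close>

section \<open>Scalars and derivatives\<close>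

lemma scalar_1 [simp]: "scalar 1 = 1"
  by transfer (simp add: const_1 zero_in_rel_ideal)

lemma scalar_0 [simp]: "scalar 0 = 0"
  by transfer (simp add: const_0 zero_in_rel_ideal)

lemma scalar_add: "scalar (c + d) = scalar c + scalar d"
  by transfer (simp add: const_add zero_in_rel_ideal)

lemma scalar_mult: "scalar (c * d) = scalar c * scalar d"
  by transfer (simp add: const_mult zero_in_rel_ideal)

lemma scalar_uminus: "scalar (- c) = - scalar c"
  by transfer (simp add: const_uminus zero_in_rel_ideal)

lemma scale_scale: "c \<cdot> (d \<cdot> f) = (c * d) \<cdot> f"
  by (simp add: scalar_mult mult.assoc)

lemma scale_commute: "scalar c * f = f * scalar c"
  by transfer (simp add: const_commute zero_in_rel_ideal)

lemma mult_scale: "f * (c \<cdot> g) = c \<cdot> (f * g)"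
  by (metis scale_commute mult.assoc)

text \<open>Each element is the class of a linear combination of words, and words are built by
  prepending letters. Identities between linear maps thus need checking only against left
  multiplication by generators, where the derivative rules are available.\<close>

lemma superalgebra_induct [case_names scalar var ge add]:
  assumes scalar: "\<And>c. P (scalar c)"
    and var: "\<And>v f. P f \<Longrightarrow> P (var v * f)"
    and ge: "\<And>i f. P f \<Longrightarrow> P (ge i * f)"
    and add: "\<And>f g. P f \<Longrightarrow> P g \<Longrightarrow> P (f + g)"
  shows "P f"
proof (induction f rule: superalgebra.abs_induct)
  case (1 p)
  show ?case
  proof (induction p rule: free_algebra_induct)
    case zero
    then show ?case using scalar[of 0] by (simp add: zero_superalgebra_def)
  next
    case (add p q)
    then show ?case using assms(4) by (metis plus_superalgebra.abs_eq)
  next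
    case (single w c)
    show ?case
    proof (induction w)
      case Nil
      then show ?case using scalar[of c] by (simp add: scalar.abs_eq const_def)
    next
      case (Cons l w)
      have "Poly_Mapping.single (l # w) c = mon [l] * Poly_Mapping.single w c" for l
        by (simp add: mon_def mult_single plus_list_def)
      then have *: "abs_superalgebra (Poly_Mapping.single (l # w) c)
          = abs_superalgebra (mon [l]) * abs_superalgebra (Poly_Mapping.single w c)" for l
        by (simp add: times_superalgebra.abs_eq)
      show ?case
        using Cons var ge by (cases l) (simp_all add: * flip: var.abs_eq ge.abs_eq)
    qed
  qed
qed

lemma deriv_scale: "\<partial> v (c \<cdot> f) = c \<cdot> \<partial> v f"
  by transfer (simp add: free_deriv_mult lin_const mon_Nil const_1 zero_in_rel_ideal)

lemma deriv_0 [simp]: "\<partial> v 0 = 0"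
  using deriv_scalar[of v 0] by simp

lemma deriv_1 [simp]: "\<partial> v 1 = 0"
  using deriv_scalar[of v 1] by simp

lemma deriv_uminus: "\<partial> v (- f) = - \<partial> v f"
  using deriv_add[of v f "- f"] by (simp add: eq_neg_iff_add_eq_0 add.commute)

lemma deriv_diff: "\<partial> v (f - g) = \<partial> v f - \<partial> v g"
  using deriv_add[of v f "- g"] by (simp add: deriv_uminus)

lemma deriv_sum: "\<partial> v (\<Sum>i\<in>I. f i) = (\<Sum>i\<in>I. \<partial> v (f i))"
  by (induction I rule: infinite_finite_induct) (simp_all add: deriv_add)

lemma deriv_var: "\<partial> v (var u) = (if u = v then 1 else 0)"
  using deriv_var_mult[of v u 1] by simp

text \<open>Moving both derivatives past a leading variable leaves terms antisymmetric in
  \<open>u\<close> and \<open>v\<close>, plus that variable times the double derivative of the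
  remaining factor.\<close>

lemma deriv_anticommute: "\<partial> u (\<partial> v f) = - \<partial> v (\<partial> u f)"
  by (induction f rule: superalgebra_induct)
     (auto simp: deriv_scalar deriv_add deriv_diff deriv_var_mult deriv_e_mult deriv_uminus)

text \<open>The scalars contain 1/2, so \<open>f + f = 0\<close> forces \<open>f = 0\<close>. This
  turns anticommutation into vanishing squares.\<close>

lemma eq_uminus_imp_0:
  fixes f :: superalgebra
  assumes "f = - f"
  shows "f = 0"
proof -
  have "f = (1/2 + 1/2) \<cdot> f" by simp
  also have "\<dots> = (1/2) \<cdot> (f + f)" by (simp only: scalar_add distrib_left distrib_right)
  also have "f + f = 0" using assms by (simp only: eq_neg_iff_add_eq_0)
  finally show ?thesis by simp
qed

lemma deriv_deriv: "\<partial> v (\<partial> v f) = 0"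
  by (rule eq_uminus_imp_0[OF deriv_anticommute])

lemma var_square: "var v * var v = 0"
  by (rule eq_uminus_imp_0[OF var_anticommute])

section \<open>Even central elements\<close>

text \<open>Evenness is encoded by its effect, a Leibniz rule without signs, which avoids setting up
  a grading on the quotient.\<close>

definition even_central :: "superalgebra \<Rightarrow> bool" where
  "even_central a \<longleftrightarrow> (\<forall>f. a * f = f * a) \<and> (\<forall>v f. \<partial> v (a * f) = \<partial> v a * f + a * \<partial> v f)"

lemma even_centralI:
  "(\<And>f. a * f = f * a) \<Longrightarrow> (\<And>v f. \<partial> v (a * f) = \<partial> v a * f + a * \<partial> v f) \<Longrightarrow> even_central a"
  by (simp add: even_central_def)

lemma even_central_commute: "even_central a \<Longrightarrow> a * f = f * a"
  by (simp add: even_central_def)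

lemma even_central_deriv: "even_central a \<Longrightarrow> \<partial> v (a * f) = \<partial> v a * f + a * \<partial> v f"
  unfolding even_central_def by blast

lemma even_central_scalar: "even_central (scalar c)"
  by (rule even_centralI) (rule scale_commute, simp add: deriv_scale deriv_scalar)

lemma even_central_add:
  assumes a: "even_central a" and b: "even_central b"
  shows "even_central (a + b)"
proof (rule even_centralI)
  show "(a + b) * f = f * (a + b)" for f
    by (simp only: distrib_left distrib_right even_central_commute[OF a, of f] even_central_commute[OF b, of f])
  show "\<partial> v ((a + b) * f) = \<partial> v (a + b) * f + (a + b) * \<partial> v f" for v f
    by (simp add: distrib_right deriv_add even_central_deriv a b)
qed

lemma even_central_mult:
  assumes a: "even_central a" and b: "even_central b"
  shows "even_central (a * b)"
proof (rule even_centralI)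
  show "a * b * f = f * (a * b)" for f
    by (metis even_central_commute[OF a] even_central_commute[OF b] mult.assoc)
  show "\<partial> v (a * b * f) = \<partial> v (a * b) * f + a * b * \<partial> v f" for v f
    by (simp add: mult.assoc even_central_deriv a b distrib_left distrib_right)
qed

lemma even_central_diff:
  assumes "even_central a" "even_central b"
  shows "even_central (a - b)"
  using even_central_add[OF assms(1) even_central_mult[OF even_central_scalar[of "- 1"] assms(2)]]
  by (simp add: scalar_uminus)

lemma even_central_sum: "(\<And>i. i \<in> I \<Longrightarrow> even_central (a i)) \<Longrightarrow> even_central (\<Sum>i\<in>I. a i)"
  by (induction I rule: infinite_finite_induct)
     (use even_central_scalar[of 0] in \<open>simp_all add: even_central_add\<close>)

lemma even_central_power: "even_central a \<Longrightarrow> even_central (a ^ k)"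
  by (induction k) (use even_central_scalar[of 1] in \<open>simp_all add: even_central_mult\<close>)

text \<open>Passing a variable or a derivative through two odd factors produces two signs, which
  cancel.\<close>

lemma even_central_var_mult: "even_central (var u * var v)"
proof -
  have "var u * var v * f = f * (var u * var v)" for f
  proof (induction f rule: superalgebra_induct)
    case (scalar c)
    then show ?case by (simp add: scale_commute)
  next
    case (var w f)
    have "var u * var v * (var w * f) = var w * (var u * var v * f)"
      by (metis (no_types, lifting) var_anticommute mult.assoc mult_minus_left mult_minus_right minus_minus)
    then show ?case using var by (simp add: mult.assoc)
  next
    case (ge i f)
    have "var u * var v * (ge i * f) = ge i * (var u * var v * f)"
      by (metis (no_types, lifting) e_var_commute mult.assoc)
    then show ?case using ge by (simp add: mult.assoc)
  qed (simp add: algebra_simps)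
  moreover have "\<partial> w (var u * var v * f) = \<partial> w (var u * var v) * f + var u * var v * \<partial> w f" for w f
    by (simp add: mult.assoc deriv_var_mult deriv_var algebra_simps)
  ultimately show ?thesis by (simp add: even_central_def)
qed

lemma var_mult_square: "(var u * var v) * (var u * var v) = 0"
proof -
  have "(var u * var v) * (var u * var v) = - (var u * var u * (var v * var v))"
    by (metis (no_types, lifting) var_anticommute mult.assoc mult_minus_left mult_minus_right)
  then show ?thesis by (simp add: var_square)
qed

section \<open>Exponentials of even nilpotent elements\<close>

text \<open>As \<open>b\<close> is central, all terms of \<open>(a + b) ^ k\<close> except
  \<open>a ^ k\<close> are multiples of \<open>b\<close>. Once \<open>a ^ k\<close> vanishes,
  squaring brings in the factor \<open>b * b = 0\<close>, so the exponent \<open>k + k\<close>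
  suffices.\<close>

lemma add_nilpotent:
  assumes a: "even_central a" "a ^ k = 0" and b: "even_central b" "b * b = 0"
  shows "\<exists>m. (a + b) ^ m = 0"
proof -
  have expand: "\<exists>r. (a + b) ^ k = a ^ k + r * b" for k
  proof (induction k)
    case 0
    have "(a + b) ^ 0 = a ^ 0 + 0 * b" by simp
    then show ?case by blast
  next
    case (Suc k)
    then obtain r where "(a + b) ^ k = a ^ k + r * b" by blast
    \<comment> \<open>The new cofactor collects the terms of
      \<open>(a + b) * (a ^ k + r * b)\<close> other than \<open>a ^ Suc k\<close>, with
      \<open>b * a ^ k\<close> rewritten as \<open>a ^ k * b\<close>.\<close>
    then have "(a + b) ^ Suc k = a ^ Suc k + (a * r + a ^ k + b * r) * b"
      by (simp add: algebra_simps even_central_commute[OF b(1), of "a ^ k"])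
    then show ?case by blast
  qed
  then obtain r where "(a + b) ^ k = r * b" using expand[of k] a by auto
  then have "(a + b) ^ (k + k) = r * b * (r * b)" by (simp only: power_add)
  also have "\<dots> = r * r * (b * b)"
    by (metis even_central_commute[OF b(1)] mult.assoc)
  finally show ?thesis using b by auto
qed

lemma sum_nilpotent:
  assumes "finite I" "\<And>i. i \<in> I \<Longrightarrow> even_central (a i) \<and> a i * a i = 0"
  shows "\<exists>m. (\<Sum>i\<in>I. a i) ^ m = 0"
  using assms
proof (induction I)
  case empty
  \<comment> \<open>Exponent 0 would fail for the empty sum, since \<open>0 ^ 0 = 1\<close>.\<close>
  show ?case by (rule exI[of _ 1]) simp
next
  case (insert i I)
  then obtain m where "(\<Sum>i\<in>I. a i) ^ m = 0" by auto
  with insert show ?case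
    using add_nilpotent[of "\<Sum>i\<in>I. a i" m "a i"] by (simp add: even_central_sum add.commute)
qed

lemma deriv_power:
  assumes "even_central a"
  shows "\<partial> v (a ^ Suc k) = of_nat (Suc k) \<cdot> (\<partial> v a * a ^ k)"
proof (induction k)
  case (Suc k)
  have "\<partial> v (a ^ Suc (Suc k)) = \<partial> v a * a ^ Suc k + a * \<partial> v (a ^ Suc k)"
    using even_central_deriv[OF assms, of v "a ^ Suc k"] by simp
  \<comment> \<open>Centrality moves \<open>a\<close> past \<open>\<partial> v a\<close> to join the
    power.\<close>
  also have "a * \<partial> v (a ^ Suc k) = of_nat (Suc k) \<cdot> (\<partial> v a * a ^ Suc k)"
    by (simp only: Suc mult_scale) (metis even_central_commute[OF assms] mult.assoc power_Suc2)
  also have "\<partial> v a * a ^ Suc k + of_nat (Suc k) \<cdot> (\<partial> v a * a ^ Suc k)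
      = of_nat (Suc (Suc k)) \<cdot> (\<partial> v a * a ^ Suc k)"
    by (simp only: of_nat_Suc[of "Suc k"] scalar_add distrib_right scalar_1 mult_1_left)
  finally show ?case .
qed simp

text \<open>Powers from \<open>m\<close> on vanish, so any cutoff \<open>N\<close> beyond
  \<open>m\<close> is allowed. The freedom in \<open>N\<close> serves the index shift when the
  series is differentiated.\<close>

lemma nilpotent_exp_eq:
  assumes "a ^ m = 0" "m \<le> N"
  shows "nilpotent_exp a = (\<Sum>k<N. (1 / fact k) \<cdot> a ^ k)"
  unfolding nilpotent_exp_def
proof (rule Sum_any.expand_superset)
  show "{k. (1 / fact k) \<cdot> a ^ k \<noteq> 0} \<subseteq> {..<N}"
  proof
    fix k assume k: "k \<in> {k. (1 / fact k) \<cdot> a ^ k \<noteq> 0}"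
    show "k \<in> {..<N}"
    proof (rule ccontr)
      assume "k \<notin> {..<N}"
      with assms(2) have "k = m + (k - m)" by simp
      then have "a ^ k = 0" using assms(1) by (metis mult_zero_left power_add)
      with k show False by simp
    qed
  qed
qed simp

lemma even_central_exp:
  assumes "even_central a" "a ^ m = 0"
  shows "even_central (nilpotent_exp a)"
  unfolding nilpotent_exp_eq[OF assms(2) order_refl]
  by (intro even_central_sum even_central_mult even_central_scalar even_central_power assms)

lemma deriv_exp:
  assumes "even_central a" "a ^ m = 0"
  shows "\<partial> v (nilpotent_exp a) = \<partial> v a * nilpotent_exp a"
proof -
  \<comment> \<open>The cutoff is \<open>Suc m\<close> because differentiation kills the constant
    term and lowers each power by one, leaving exactly \<open>m\<close> terms.\<close>
  have "\<partial> v (nilpotent_exp a) = (\<Sum>k<Suc m. (1 / fact k) \<cdot> \<partial> v (a ^ k))"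
    using nilpotent_exp_eq[OF assms(2), of "Suc m"] by (simp only: deriv_sum deriv_scale le_SucI order_refl)
  also have "\<dots> = (\<Sum>k<m. (1 / fact (Suc k)) \<cdot> \<partial> v (a ^ Suc k))"
    by (subst sum.lessThan_Suc_shift) simp
  also have "\<dots> = (\<Sum>k<m. \<partial> v a * ((1 / fact k) \<cdot> a ^ k))"
  proof (rule sum.cong)
    fix k
    have "(1 / fact (Suc k)) \<cdot> \<partial> v (a ^ Suc k) = (1 / fact (Suc k) * of_nat (Suc k)) \<cdot> (\<partial> v a * a ^ k)"
      by (simp only: deriv_power[OF assms(1)] scale_scale)
    also have "1 / fact (Suc k) * of_nat (Suc k) = (1 / fact k :: complex)"
      by (simp del: of_nat_Suc)
    finally show "(1 / fact (Suc k)) \<cdot> \<partial> v (a ^ Suc k) = \<partial> v a * ((1 / fact k) \<cdot> a ^ k)"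
      by (simp only: mult_scale)
  qed simp
  finally show ?thesis
    by (simp only: nilpotent_exp_eq[OF assms(2) order_refl] sum_distrib_left)
qed

section \<open>The kernel\<close>

text \<open>The argument of \<open>nilpotent_exp\<close> in \<open>fourier_kernel\<close>, named so
  that its derivatives can be stated.\<close>

definition kernel_exponent :: "complex \<Rightarrow> nat \<Rightarrow> superalgebra" where
  "kernel_exponent \<sigma> n =
     (- \<sigma> * \<i> / 2) \<cdot> (\<Sum>j=1..n. gx (2*j-1) * gy (2*j) - gx (2*j) * gy (2*j-1))"

lemma even_central_kernel_exponent: "even_central (kernel_exponent \<sigma> n)"
  unfolding kernel_exponent_def
  by (intro even_central_mult even_central_scalar even_central_sum even_central_diff even_central_var_mult)

lemma kernel_exponent_nilpotent: "\<exists>m. kernel_exponent \<sigma> n ^ m = 0"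
proof -
  let ?c = "- \<sigma> * \<i> / 2"
  \<comment> \<open>The Boolean selects one of the two products for each \<open>j\<close>, and the
    minus sign goes into the scalar. Every summand is then a scaled product of two variables, hence
    even, central and of square zero.\<close>
  let ?a = "\<lambda>(j, b). if b then ?c \<cdot> (gx (2*j-1) * gy (2*j)) else (- ?c) \<cdot> (gx (2*j) * gy (2*j-1))"
  have "kernel_exponent \<sigma> n = (\<Sum>j=1..n. \<Sum>b\<in>UNIV. ?a (j, b))"
    by (simp add: kernel_exponent_def UNIV_bool sum_distrib_left right_diff_distrib scalar_uminus)
  also have "\<dots> = (\<Sum>p\<in>{1..n} \<times> UNIV. ?a p)"
    by (simp add: sum.cartesian_product)
  finally have eq: "kernel_exponent \<sigma> n = (\<Sum>p\<in>{1..n} \<times> UNIV. ?a p)" .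
  have sq: "(c \<cdot> (var u * var v)) * (c \<cdot> (var u * var v)) = 0" for c u v
    by (metis mult.assoc mult_scale mult_zero_right var_mult_square)
  show ?thesis
    unfolding eq
    by (rule sum_nilpotent)
       (auto simp: sq simp del: mult_minus_left intro!: even_central_mult[of "scalar _"] even_central_scalar even_central_var_mult)
qed

lemma even_central_kernel: "even_central (fourier_kernel \<sigma> n)"
  using even_central_exp even_central_kernel_exponent kernel_exponent_nilpotent
  by (metis fourier_kernel_def kernel_exponent_def)

lemma deriv_kernel_mult:
  "\<partial> v (fourier_kernel \<sigma> n * f)
    = \<partial> v (kernel_exponent \<sigma> n) * (fourier_kernel \<sigma> n * f) + fourier_kernel \<sigma> n * \<partial> v f"
proof -
  have "\<partial> v (fourier_kernel \<sigma> n) = \<partial> v (kernel_exponent \<sigma> n) * fourier_kernel \<sigma> n"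
    using deriv_exp even_central_kernel_exponent kernel_exponent_nilpotent
    by (metis fourier_kernel_def kernel_exponent_def)
  then show ?thesis
    by (simp add: even_central_deriv[OF even_central_kernel] mult.assoc)
qed

text \<open>Each variable occurs in a single product. A derivative in a \<open>y\<close> variable
  must first pass the \<open>x\<close> factor, which adds a sign to the one in the exponent.\<close>

lemma deriv_kernel_exponent:
  assumes "j \<in> {1..n}"
  shows "\<partial> (X (2*j-1)) (kernel_exponent \<sigma> n) = (- \<sigma> * \<i> / 2) \<cdot> gy (2*j)"
    and "\<partial> (X (2*j)) (kernel_exponent \<sigma> n) = (\<sigma> * \<i> / 2) \<cdot> gy (2*j-1)"
    and "\<partial> (Y (2*j-1)) (kernel_exponent \<sigma> n) = (- \<sigma> * \<i> / 2) \<cdot> gx (2*j)"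
    and "\<partial> (Y (2*j)) (kernel_exponent \<sigma> n) = (\<sigma> * \<i> / 2) \<cdot> gx (2*j-1)"
proof -
  \<comment> \<open>Subtraction on \<open>nat\<close> truncates, so positivity of the indices keeps
    odd and even labels apart.\<close>
  have odd: "2 * i - 1 = 2 * j - 1 \<longleftrightarrow> i = j" and parity: "2 * i \<noteq> 2 * j - 1" "2 * i - 1 \<noteq> 2 * j"
    if "i \<in> {1..n}" for i :: nat
    using that assms by (auto; presburger)+
  have D: "\<partial> v (kernel_exponent \<sigma> n) = (- \<sigma> * \<i> / 2) \<cdot> g j"
    if "\<And>i. i \<in> {1..n} \<Longrightarrow>
      \<partial> v (gx (2*i-1) * gy (2*i) - gx (2*i) * gy (2*i-1)) = (if i = j then g i else 0)" for v g
    unfolding kernel_exponent_def deriv_scale deriv_sum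
    by (rule arg_cong2[OF refl]) (use that assms in simp)
  show "\<partial> (X (2*j-1)) (kernel_exponent \<sigma> n) = (- \<sigma> * \<i> / 2) \<cdot> gy (2*j)"
    by (rule D) (use odd parity in \<open>simp add: deriv_diff deriv_var_mult deriv_var\<close>)
  have "\<partial> (X (2*j)) (kernel_exponent \<sigma> n) = (- \<sigma> * \<i> / 2) \<cdot> (- gy (2*j-1))"
    by (rule D[where g = "\<lambda>i. - gy (2*i-1)"])
       (use odd parity in \<open>simp add: deriv_diff deriv_var_mult deriv_var\<close>)
  then show "\<partial> (X (2*j)) (kernel_exponent \<sigma> n) = (\<sigma> * \<i> / 2) \<cdot> gy (2*j-1)"
    by (simp add: scalar_uminus)
  show "\<partial> (Y (2*j-1)) (kernel_exponent \<sigma> n) = (- \<sigma> * \<i> / 2) \<cdot> gx (2*j)"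
    by (rule D[where g = "\<lambda>i. gx (2*i)"])
       (use odd parity in \<open>simp add: deriv_diff deriv_var_mult deriv_var\<close>)
  have "\<partial> (Y (2*j)) (kernel_exponent \<sigma> n) = (- \<sigma> * \<i> / 2) \<cdot> (- gx (2*j-1))"
    by (rule D[where g = "\<lambda>i. - gx (2*i-1)"])
       (use odd parity in \<open>simp add: deriv_diff deriv_var_mult deriv_var\<close>)
  then show "\<partial> (Y (2*j)) (kernel_exponent \<sigma> n) = (\<sigma> * \<i> / 2) \<cdot> gx (2*j-1)"
    by (simp add: scalar_uminus)
qed

section \<open>The Berezin integral\<close>

lemma fold_deriv_add:
  "fold (\<lambda>i. \<partial> (X i)) is (f + g) = fold (\<lambda>i. \<partial> (X i)) is f + fold (\<lambda>i. \<partial> (X i)) is g"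
  by (induction "is" arbitrary: f g) (simp_all add: deriv_add)

lemma fold_deriv_commute:
  assumes "\<And>i f. \<partial> (X i) (T f) = T (\<partial> (X i) f)"
  shows "fold (\<lambda>i. \<partial> (X i)) is (T f) = T (fold (\<lambda>i. \<partial> (X i)) is f)"
  by (induction "is" arbitrary: f) (simp_all add: assms)

text \<open>The derivatives are passed two at a time, and each pair contributes two cancelling
  signs.\<close>

lemma fold_deriv_anticommute:
  assumes "\<And>i f. \<partial> (X i) (T f) = - T (\<partial> (X i) f)" and "even (length is)"
  shows "fold (\<lambda>i. \<partial> (X i)) is (T f) = T (fold (\<lambda>i. \<partial> (X i)) is f)"
  using assms(2)
proof (induction "length is" arbitrary: "is" f rule: less_induct)
  case less
  show ?case
  \<comment> \<open>This rule separates the empty list, singletons and lists with at least two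
    entries. Evenness of the length excludes singletons.\<close>
  proof (cases "is" rule: remdups_adj.cases)
    case (3 i j js)
    have "\<partial> (X j) (\<partial> (X i) (T f)) = T (\<partial> (X j) (\<partial> (X i) f))"
      by (simp add: assms deriv_uminus)
    then show ?thesis using less 3 by simp
  qed (use less in simp_all)
qed

text \<open>The last list entry gives the outermost derivative, hence the induction from the right:
  either it is \<open>\<partial> (X i)\<close> and the square vanishes, or
  \<open>\<partial> (X i)\<close> anticommutes past it.\<close>

lemma deriv_fold_deriv:
  "i \<in> set is \<Longrightarrow> \<partial> (X i) (fold (\<lambda>i. \<partial> (X i)) is f) = 0"
proof (induction "is" rule: rev_induct)
  case (snoc k ks)
  then show ?case
    by (cases "i = k") (simp_all add: deriv_deriv deriv_anticommute[of "X i"])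
qed simp

lemma berezin_add: "berezin n (f + g) = berezin n f + berezin n g"
  by (simp only: berezin_def fold_deriv_add distrib_left)

lemma berezin_commute:
  assumes "\<And>i f. \<partial> (X i) (T f) = T (\<partial> (X i) f)" and "\<And>c f. T (c \<cdot> f) = c \<cdot> T f"
  shows "berezin n (T f) = T (berezin n f)"
  by (simp only: berezin_def fold_deriv_commute[of T, OF assms(1)] assms(2))

text \<open>The \<open>2 * n\<close> signs cancel. Suitable \<open>T\<close> are multiplication by
  \<open>gy i\<close> and derivatives in any variable.\<close>

lemma berezin_anticommute:
  assumes "\<And>i f. \<partial> (X i) (T f) = - T (\<partial> (X i) f)" and "\<And>c f. T (c \<cdot> f) = c \<cdot> T f"
  shows "berezin n (T f) = T (berezin n f)"
proof -
  have "even (length [1..<2*n+1])" by simp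
  then show ?thesis
    by (simp only: berezin_def fold_deriv_anticommute[of T, OF assms(1)] assms(2))
qed

lemma berezin_scale: "berezin n (c \<cdot> f) = c \<cdot> berezin n f"
  by (rule berezin_commute) (rule deriv_scale mult_scale)+

lemma berezin_ge: "berezin n (ge i * f) = ge i * berezin n f"
  by (rule berezin_commute) (rule deriv_e_mult mult_scale)+

lemma berezin_gy: "berezin n (gy i * f) = gy i * berezin n f"
  by (rule berezin_anticommute) (simp add: deriv_var_mult, rule mult_scale)

lemma berezin_deriv: "berezin n (\<partial> v f) = \<partial> v (berezin n f)"
  by (rule berezin_anticommute) (rule deriv_anticommute deriv_scale)+

text \<open>Integrals of total derivatives vanish: once outside the integral,
  \<open>\<partial> (X i)\<close> meets its own copy among the derivatives that form the
  integral.\<close>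

lemma berezin_deriv_X:
  assumes "i \<in> {1..2*n}"
  shows "berezin n (\<partial> (X i) f) = 0"
proof -
  have "i \<in> set [1..<2*n+1]" using assms by auto
  then show ?thesis
    unfolding berezin_deriv by (simp only: berezin_def deriv_scale deriv_fold_deriv mult_zero_right)
qed

section \<open>The Fourier transform\<close>

lemma fourier_add: "fourier \<sigma> n (f + g) = fourier \<sigma> n f + fourier \<sigma> n g"
  by (simp only: fourier_def berezin_add distrib_left)

lemma fourier_scale: "fourier \<sigma> n (c \<cdot> f) = c \<cdot> fourier \<sigma> n f"
  by (simp only: fourier_def mult_scale[of "fourier_kernel _ _"] berezin_scale
      mult_scale[of "scalar (complex_of_real _)"])

lemma fourier_0 [simp]: "fourier \<sigma> n 0 = 0"
  using fourier_scale[of \<sigma> n 0 0] by simp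

lemma fourier_diff: "fourier \<sigma> n (f - g) = fourier \<sigma> n f - fourier \<sigma> n g"
  using fourier_add[of \<sigma> n "f - g" g] by simp

lemma fourier_sum: "fourier \<sigma> n (\<Sum>i\<in>I. f i) = (\<Sum>i\<in>I. fourier \<sigma> n (f i))"
  by (induction I rule: infinite_finite_induct) (simp_all add: fourier_add)

lemma fourier_ge: "fourier \<sigma> n (ge i * f) = ge i * fourier \<sigma> n f"
proof -
  have "fourier_kernel \<sigma> n * (ge i * f) = ge i * (fourier_kernel \<sigma> n * f)"
    by (metis even_central_commute[OF even_central_kernel] mult.assoc)
  then show ?thesis by (simp only: fourier_def berezin_ge mult_scale)
qed

text \<open>Integration by parts without boundary term: the derivative falls on the kernel with a
  minus sign, and \<open>gy k\<close> leaves the integral.\<close>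

lemma fourier_deriv_X:
  assumes "i \<in> {1..2*n}" and "\<partial> (X i) (kernel_exponent \<sigma> n) = c \<cdot> gy k"
  shows "fourier \<sigma> n (\<partial> (X i) f) = (- c) \<cdot> (gy k * fourier \<sigma> n f)"
proof -
  let ?K = "fourier_kernel \<sigma> n"
  have "0 = berezin n (\<partial> (X i) (?K * f))"
    using assms(1) by (simp add: berezin_deriv_X)
  also have "\<dots> = c \<cdot> (gy k * berezin n (?K * f)) + berezin n (?K * \<partial> (X i) f)"
    by (simp add: deriv_kernel_mult berezin_add assms(2) mult.assoc berezin_scale berezin_gy)
  finally have "berezin n (?K * \<partial> (X i) f) = (- c) \<cdot> (gy k * berezin n (?K * f))"
    by (simp add: scalar_uminus eq_neg_iff_add_eq_0 add.commute)
  then show ?thesis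
    by (simp only: fourier_def mult_scale[of "gy _"] mult_scale[of "scalar (complex_of_real _)"])
qed

text \<open>The derivative passes under the integral and acts on the kernel alone, since
  \<open>f\<close> is independent of this variable.\<close>

lemma deriv_Y_fourier:
  assumes "\<partial> (Y i) f = 0" and "\<partial> (Y i) (kernel_exponent \<sigma> n) = c \<cdot> gx k"
  shows "\<partial> (Y i) (fourier \<sigma> n f) = c \<cdot> fourier \<sigma> n (gx k * f)"
proof -
  let ?K = "fourier_kernel \<sigma> n"
  have "gx k * (?K * f) = ?K * (gx k * f)"
    by (metis even_central_commute[OF even_central_kernel] mult.assoc)
  then have "\<partial> (Y i) (?K * f) = c \<cdot> (?K * (gx k * f))"
    by (simp add: deriv_kernel_mult assms mult.assoc)
  then show ?thesis
    by (simp only: fourier_def deriv_scale berezin_deriv[symmetric] berezin_scale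
        mult_scale[of "scalar (complex_of_real _)"])
qed

text \<open>Matches \<open>vector_variable\<close>, summed over single generators, with
  \<open>dirac\<close>, summed over pairs.\<close>

lemma sum_even_odd: "(\<Sum>j=1..2*n. f j) = (\<Sum>j=1..n. f (2*j-1) + f (2*j))"
  for f :: "nat \<Rightarrow> 'a::comm_monoid_add"
  by (induction n) (simp_all add: add.assoc)

text \<open>The kernel trades the derivative in one variable of a pair for the \<open>y\<close>
  variable of its partner, whose index is that of the accompanying \<open>ge\<close>. The factor 2
  of \<open>dirac\<close> cancels the 1/2 of the kernel.\<close>

lemma fourier_dirac:
  "fourier \<sigma> n (dirac n X f) = (\<sigma> * \<i>) \<cdot> (vector_variable n Y * fourier \<sigma> n f)"
proof -
  let ?F = "fourier \<sigma> n f"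
  have "fourier \<sigma> n (dirac n X f) = (\<Sum>j=1..n.
      2 \<cdot> (ge (2*j) * fourier \<sigma> n (\<partial> (X (2*j-1)) f) - ge (2*j-1) * fourier \<sigma> n (\<partial> (X (2*j)) f)))"
    by (simp only: dirac_def fourier_scale fourier_sum fourier_diff fourier_ge sum_distrib_left)
  also have "\<dots> = (\<Sum>j=1..n. (\<sigma> * \<i>) \<cdot> (gy (2*j-1) * ge (2*j-1) * ?F + gy (2*j) * ge (2*j) * ?F))"
  proof (rule sum.cong)
    fix j assume j: "j \<in> {1..n}"
    then have range: "2*j-1 \<in> {1..2*n}" "2*j \<in> {1..2*n}" by auto
    have "fourier \<sigma> n (\<partial> (X (2*j-1)) f) = (- (- \<sigma> * \<i> / 2)) \<cdot> (gy (2*j) * ?F)"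
        "fourier \<sigma> n (\<partial> (X (2*j)) f) = (- (\<sigma> * \<i> / 2)) \<cdot> (gy (2*j-1) * ?F)"
      using fourier_deriv_X range deriv_kernel_exponent(1,2)[OF j] by blast+
    then have "2 \<cdot> (ge (2*j) * fourier \<sigma> n (\<partial> (X (2*j-1)) f) - ge (2*j-1) * fourier \<sigma> n (\<partial> (X (2*j)) f))
      = (2 * (\<sigma> * \<i> / 2)) \<cdot> (ge (2*j) * (gy (2*j) * ?F)) + (2 * (\<sigma> * \<i> / 2)) \<cdot> (ge (2*j-1) * (gy (2*j-1) * ?F))"
      by (simp only: mult_scale[of "ge _"] right_diff_distrib scale_scale)
         (simp add: scalar_uminus)
    then show "2 \<cdot> (ge (2*j) * fourier \<sigma> n (\<partial> (X (2*j-1)) f) - ge (2*j-1) * fourier \<sigma> n (\<partial> (X (2*j)) f))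
      = (\<sigma> * \<i>) \<cdot> (gy (2*j-1) * ge (2*j-1) * ?F + gy (2*j) * ge (2*j) * ?F)"
      by (simp add: distrib_left add.commute e_var_commute[symmetric] mult.assoc)
  qed simp
  finally show ?thesis
    by (simp only: vector_variable_def sum_even_odd sum_distrib_right sum_distrib_left distrib_right)
qed

lemma fourier_vector_variable:
  assumes \<sigma>: "\<sigma> \<in> {1, -1}" and f: "\<And>i. \<partial> (Y i) f = 0"
  shows "fourier \<sigma> n (vector_variable n X * f) = (\<sigma> * \<i>) \<cdot> dirac n Y (fourier \<sigma> n f)"
proof -
  let ?F = "fourier \<sigma> n f"
  \<comment> \<open>The computation starts from the right-hand side, because
    \<open>deriv_Y_fourier\<close> rewrites derivatives in \<open>y\<close> as multiplications by
    \<open>x\<close> under the transform.\<close>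
  have "(\<sigma> * \<i>) \<cdot> dirac n Y ?F
      = (\<Sum>j=1..n. (\<sigma> * \<i> * 2) \<cdot> (ge (2*j) * \<partial> (Y (2*j-1)) ?F - ge (2*j-1) * \<partial> (Y (2*j)) ?F))"
    by (simp only: dirac_def scale_scale sum_distrib_left)
  also have "\<dots> = (\<Sum>j=1..n. fourier \<sigma> n (gx (2*j-1) * ge (2*j-1) * f)
      + fourier \<sigma> n (gx (2*j) * ge (2*j) * f))"
  proof (rule sum.cong)
    fix j assume j: "j \<in> {1..n}"
    \<comment> \<open>Here \<open>\<sigma> * \<sigma> = 1\<close> enters.\<close>
    have c: "\<sigma> * \<i> * 2 * (- \<sigma> * \<i> / 2) = 1" "\<sigma> * \<i> * 2 * (\<sigma> * \<i> / 2) = - 1"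
      using \<sigma> by auto
    have "\<partial> (Y (2*j-1)) ?F = (- \<sigma> * \<i> / 2) \<cdot> fourier \<sigma> n (gx (2*j) * f)"
        "\<partial> (Y (2*j)) ?F = (\<sigma> * \<i> / 2) \<cdot> fourier \<sigma> n (gx (2*j-1) * f)"
      using deriv_Y_fourier f deriv_kernel_exponent(3,4)[OF j] by blast+
    then have "(\<sigma> * \<i> * 2) \<cdot> (ge (2*j) * \<partial> (Y (2*j-1)) ?F - ge (2*j-1) * \<partial> (Y (2*j)) ?F)
      = ge (2*j-1) * fourier \<sigma> n (gx (2*j-1) * f) + ge (2*j) * fourier \<sigma> n (gx (2*j) * f)"
      by (simp only: mult_scale[of "ge _"] right_diff_distrib scale_scale c) (simp add: scalar_uminus)
    then show "(\<sigma> * \<i> * 2) \<cdot> (ge (2*j) * \<partial> (Y (2*j-1)) ?F - ge (2*j-1) * \<partial> (Y (2*j)) ?F)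
      = fourier \<sigma> n (gx (2*j-1) * ge (2*j-1) * f) + fourier \<sigma> n (gx (2*j) * ge (2*j) * f)"
      by (simp only: fourier_ge e_var_commute[symmetric] mult.assoc)
  qed simp
  finally show ?thesis
    by (simp only: vector_variable_def sum_even_odd sum_distrib_right distrib_right fourier_sum fourier_add)
qed

lemma deriv_Y_Lambda: "f \<in> Lambda m \<Longrightarrow> \<partial> (Y i) f = 0"
proof -
  assume "f \<in> Lambda m"
  \<comment> \<open>Strengthened to: left multiplication by \<open>f\<close> preserves the kernel of
    \<open>\<partial> (Y i)\<close>. This property passes to products by associativity, using only
    the Leibniz rules for scalars and single variables. Taking \<open>g = 1\<close> gives the
    claim.\<close>
  then have "\<forall>g. \<partial> (Y i) g = 0 \<longrightarrow> \<partial> (Y i) (f * g) = 0"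
    by (induction rule: Lambda.induct)
       (simp_all add: deriv_scale deriv_var_mult deriv_add distrib_right mult.assoc)
  from this[rule_format, of 1] show ?thesis by simp
qed

text \<open>Permits a second use of \<open>fourier_vector_variable\<close>: the product contains
  \<open>ge\<close> factors, so independence of \<open>y\<close> is tracked instead of membership in
  \<open>Lambda\<close>.\<close>

lemma deriv_Y_vector_variable:
  assumes "\<partial> (Y i) f = 0"
  shows "\<partial> (Y i) (vector_variable n X * f) = 0"
  using assms by (simp add: vector_variable_def sum_distrib_right deriv_sum mult.assoc
      deriv_var_mult deriv_e_mult)

lemma dirac_scale: "dirac n Z (c \<cdot> f) = c \<cdot> dirac n Z f"
  unfolding dirac_def
  by (simp only: deriv_scale mult_scale[of "ge _"] right_diff_distrib[symmetric]
      sum_distrib_left[symmetric] mult_scale[of "scalar 2"])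

theorem corollary1:
  fixes n :: nat and \<sigma> :: complex and g :: superalgebra
  assumes "\<sigma> \<in> {1, -1}"
    and "g \<in> Lambda (2 * n)"
  shows "fourier \<sigma> n (dirac n X g) = (\<sigma> * \<i>) \<cdot> (vector_variable n Y * fourier \<sigma> n g)
    \<and> fourier \<sigma> n (laplace n X g) = - ((vector_variable n Y)\<^sup>2 * fourier \<sigma> n g)
    \<and> fourier \<sigma> n (vector_variable n X * g) = (\<sigma> * \<i>) \<cdot> dirac n Y (fourier \<sigma> n g)
    \<and> fourier \<sigma> n ((vector_variable n X)\<^sup>2 * g) = - laplace n Y (fourier \<sigma> n g)"
proof (intro conjI)
  \<comment> \<open>The second-order relations are the first-order ones applied twice, and this
    constant is the source of their minus signs.\<close>
  have sq: "\<sigma> * \<i> * (\<sigma> * \<i>) = - 1" using assms(1) by auto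
  note g = deriv_Y_Lambda[OF assms(2)]
  show "fourier \<sigma> n (dirac n X g) = (\<sigma> * \<i>) \<cdot> (vector_variable n Y * fourier \<sigma> n g)"
    by (rule fourier_dirac)
  have "fourier \<sigma> n (laplace n X g)
      = (\<sigma> * \<i> * (\<sigma> * \<i>)) \<cdot> (vector_variable n Y * (vector_variable n Y * fourier \<sigma> n g))"
    by (simp only: laplace_def fourier_dirac mult_scale[of "vector_variable _ _"] scale_scale)
  then show "fourier \<sigma> n (laplace n X g) = - ((vector_variable n Y)\<^sup>2 * fourier \<sigma> n g)"
    by (simp only: sq scalar_uminus) (simp add: power2_eq_square mult.assoc)
  show "fourier \<sigma> n (vector_variable n X * g) = (\<sigma> * \<i>) \<cdot> dirac n Y (fourier \<sigma> n g)"
    by (rule fourier_vector_variable[OF assms(1) g])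
  have "fourier \<sigma> n (vector_variable n X * (vector_variable n X * g))
      = (\<sigma> * \<i> * (\<sigma> * \<i>)) \<cdot> laplace n Y (fourier \<sigma> n g)"
    by (simp only: laplace_def fourier_vector_variable[OF assms(1)] g deriv_Y_vector_variable
        dirac_scale scale_scale)
  then show "fourier \<sigma> n ((vector_variable n X)\<^sup>2 * g) = - laplace n Y (fourier \<sigma> n g)"
    by (simp only: sq scalar_uminus) (simp add: power2_eq_square mult.assoc)
qed

end
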